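(* Let $Y$ be a locally compact, second-countable metrisable space, and let $f:\mathbb{R}^2\to Y$ be a function whose graph $\{(x,f(x)) : x\in\mathbb{R}^2\}$ is a closed subset of $\mathbb{R}^2\times Y$ and is connected and locally connected (as a subspace of $\mathbb{R}^2\times Y$). Let $D_f\subset\mathbb{R}^2$ be the set of all points of discontinuity of $f$. Then the graph of the restriction $f|D_f$, i.e. the subspace $\{(x,f(x)) : x\in D_f\}$ of $\mathbb{R}^2\times Y$, is locally connected.
   Context: $D_f$ denotes the set of all points $x$ of the domain at which $f$ is not continuous (as a function on the whole domain). Graphs carry the subspace topology of the product space. The empty space counts as locally connected. *)

theory Defs
  imports "HOL-Analysis.Analysis"
begin

definition graph_over :: "'a set \<Rightarrow> ('a \<Rightarrow> 'b) \<Rightarrow> ('a \<times> 'b) set" where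
  "graph_over S f = {(x, f x) |x. x \<in> S}"

text \<open>Continuity at a point refers to the function on the whole domain space.
  For a map into \<open>topspace Y\<close>, failure of \<open>topcontinuous_at\<close> at a point of
  \<open>topspace X\<close> is exactly discontinuity there.\<close>

definition discontinuity_set :: "'a topology \<Rightarrow> 'b topology \<Rightarrow> ('a \<Rightarrow> 'b) \<Rightarrow> 'a set" where
  "discontinuity_set X Y f = {x \<in> topspace X. \<not> topcontinuous_at X Y f x}"

end

theory Submission
  imports Defs
begin

text \<open>
  Let \<open>G\<close> be the graph. The vertical projection is injective on \<open>G\<close>, so it embeds compact
  pieces of \<open>G\<close> into the plane. Near a point \<open>(x, f x)\<close> the graph therefore looks like a compact
  planar set \<open>C\<close>, intersected with a small disc around \<open>x\<close>
  (\<open>exists_compact_graph_patch\<close>), and in this disc the discontinuities of \<open>f\<close> are exactly the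
  frontier points of \<open>C\<close> (\<open>topcontinuous_at_iff_interior_graph_patch\<close>). So it has to be shown that
  the frontier of \<open>C\<close> is locally connected near \<open>x\<close>. Local connectedness of \<open>C\<close> does not suffice
  for this: infinitely many round holes that shrink to \<open>x\<close> would be a counterexample.

  Connectedness of \<open>G\<close> excludes such holes. If \<open>L\<close> is a compact subset of \<open>C\<close> in the disc, then the
  part of the graph over the points that lie inside \<open>L\<close> but outside \<open>C\<close> is open and closed in
  \<open>G\<close>, hence empty: no compact subset of \<open>C\<close> near \<open>x\<close> surrounds a point off \<open>C\<close>
  (\<open>inside_subset_graph_patch\<close>). Consequently any two points off \<open>C\<close> can be joined in the
  complement of any such \<open>L\<close>.

  The planar core is \<open>frontier_connected_im_kleinen\<close>. Suppose frontier points \<open>y\<close> arbitrarily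
  close to \<open>x\<close> are not joined to \<open>x\<close> by a connected part of the frontier within a disc around
  \<open>x\<close>. Then \<open>x\<close> and \<open>y\<close> are separated in the disc by a connected set \<open>S\<close> that lies in the interior
  of \<open>C\<close> (\<open>exists_separator_in_interior\<close>). Finitely many small continua \<open>Z \<subseteq> C\<close>
  cover the part of \<open>C\<close> on the bounding circle, so two separators \<open>S\<^sub>1\<close> and \<open>S\<^sub>2\<close>, the second one
  belonging to a point \<open>y\<close> much closer to \<open>x\<close> than \<open>S\<^sub>1\<close>, meet the same of these continua; let
  \<open>K\<close> be the union of these. By Janiszewski's theorem, \<open>S\<^sub>1 \<union> S\<^sub>2 \<union> K\<close>, which cannot separate
  points off \<open>C\<close>, together with \<open>S\<^sub>1 \<union> K\<close> and the circle, which stay away from \<open>x\<close> and \<open>y\<close>, does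
  not separate points off \<open>C\<close> that are close to \<open>x\<close> and to \<open>y\<close>: the two sets intersect in the
  connected set \<open>S\<^sub>1 \<union> K\<close>. But their union contains \<open>S\<^sub>2\<close> and the circle, which separate these
  points.
\<close>

section \<open>Separation in the plane and in balls\<close>

lemma connected_component_homeomorphism:
  assumes hom: "homeomorphism A B h k" and "S \<subseteq> A" and "x \<in> A" and "y \<in> A"
    and "connected_component (h ` S) (h x) (h y)"
  shows "connected_component S x y"
proof -
  obtain T where T: "connected T" "T \<subseteq> h ` S" "h x \<in> T" "h y \<in> T"
    using assms(5) by (auto simp: connected_component_def)
  have kh: "\<And>z. z \<in> A \<Longrightarrow> k (h z) = z"
    using hom by (rule homeomorphism_apply1)
  have "h ` S \<subseteq> B"
    using hom \<open>S \<subseteq> A\<close> by (auto simp: homeomorphism_def)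
  then have "continuous_on T k"
    using hom T(2) by (meson continuous_on_subset homeomorphism_cont2 order_trans)
  then have "connected (k ` T)"
    using T(1) connected_continuous_image by blast
  moreover have "k ` T \<subseteq> S"
    using T(2) \<open>S \<subseteq> A\<close> kh by fastforce
  moreover have "x \<in> k ` T" "y \<in> k ` T"
    using T(3,4) kh assms(3,4) by (metis image_eqI)+
  ultimately show ?thesis
    unfolding connected_component_def by blast
qed

text \<open>
  Janiszewski's theorem for the complex plane, carried over by a linear isometry to every
  two-dimensional Euclidean space.
\<close>

lemma Janiszewski_plane:
  fixes a b :: "'a::euclidean_space"
  assumes dim: "DIM('a) = 2" and "compact S" "compact T" "connected (S \<inter> T)"
    and S: "connected_component (- S) a b" and T: "connected_component (- T) a b"
  shows "connected_component (- (S \<union> T)) a b"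
proof -
  obtain h :: "'a \<Rightarrow> complex" and k where "linear h" "linear k"
    and kh: "\<And>x. k (h x) = x" and hk: "\<And>y. h (k y) = y"
    using dim isomorphisms_UNIV_UNIV[where 'M = 'a and 'N = complex] by (metis DIM_complex)
  have "inj h" by (rule inj_on_inverseI[of UNIV k]) (rule kh)
  have "surj h" by (rule surjI) (rule hk)
  have "surj k" by (rule surjI) (rule kh)
  have hom: "homeomorphism UNIV UNIV h k" "homeomorphism UNIV UNIV k h"
    unfolding homeomorphism_def
    using \<open>linear h\<close> \<open>linear k\<close> \<open>surj h\<close> \<open>surj k\<close> kh hk
    by (simp_all add: linear_continuous_on linear_linear)
  have comp: "h ` (- X) = - h ` X" for X
    using \<open>inj h\<close> \<open>surj h\<close> by (intro bij_image_Compl_eq bijI)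
  have cont: "continuous_on X h" for X
    by (simp add: \<open>linear h\<close> linear_continuous_on linear_linear)
  have conn: "connected_component (- h ` X) (h a) (h b)"
    if "connected_component (- X) a b" for X
  proof -
    have "k ` (- h ` X) = - X" using kh by (simp add: comp[symmetric] image_image)
    then show ?thesis
      using connected_component_homeomorphism[OF hom(2), of "- h ` X" "h a" "h b"] that kh
      by simp
  qed
  have "connected_component (- (h ` S \<union> h ` T)) (h a) (h b)"
  proof (rule Janiszewski)
    show "compact (h ` S)" "closed (h ` T)"
      using assms(2,3) cont by (auto intro: compact_continuous_image compact_imp_closed)
    have "h ` S \<inter> h ` T = h ` (S \<inter> T)" using \<open>inj h\<close> by (simp add: image_Int)
    then show "connected (h ` S \<inter> h ` T)"
      using assms(4) cont connected_continuous_image by metis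
  qed (use S T conn in auto)
  then have "connected_component (h ` (- (S \<union> T))) (h a) (h b)"
    by (simp only: comp image_Un)
  then show ?thesis
    using connected_component_homeomorphism[OF hom(1)] by blast
qed

text \<open>
  An open ball is homeomorphic to the whole space, where a closed set that separates two points
  has a component that separates them. The component must be taken inside the ball: in the whole
  space one would have to add the sphere, which may lie in the separating component.
\<close>

lemma separation_in_ball_by_component:
  fixes c :: "'a::euclidean_space"
  assumes "0 < r" and clo: "closedin (top_of_set (ball c r)) S"
    and xy: "x \<in> ball c r" "y \<in> ball c r"
    and sep: "\<not> connected_component (ball c r - S) x y"
  obtains K where "connected K" "K \<subseteq> S" "closedin (top_of_set (ball c r)) K"
    "\<not> connected_component (ball c r - K) x y"
proof -
  have "ball c r homeomorphic (UNIV :: 'a set)"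
    using homeomorphic_balls(1)[OF \<open>0 < r\<close> zero_less_one, of c 0] homeomorphic_ball01_UNIV
      homeomorphic_trans by blast
  then obtain h k where hom: "homeomorphism (ball c r) (UNIV :: 'a set) h k"
    unfolding homeomorphic_def by blast
  then have inj: "inj_on h (ball c r)"
    by (intro inj_on_inverseI[of _ k]) (rule homeomorphism_apply1)
  have im: "h ` ball c r = UNIV"
    using hom by (simp add: homeomorphism_def)
  have diff: "h ` (ball c r - X) = - h ` X" if "X \<subseteq> ball c r" for X
    using inj_on_image_set_diff[of h "ball c r" "ball c r" X] that
      inj im by (simp only: Compl_eq_Diff_UNIV Diff_subset)
  have S: "S \<subseteq> ball c r" using clo closedin_imp_subset by blast
  have "closed (h ` S)"
    using homeomorphism_imp_closed_map[OF hom clo] by simp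
  moreover have "\<not> connected_component (- h ` S) (h x) (h y)"
    using connected_component_homeomorphism[OF hom, of "ball c r - S" x y] xy sep diff[OF S]
    by auto
  ultimately obtain L where L: "L \<in> components (h ` S)" "\<not> connected_component (- L) (h x) (h y)"
    by (metis separation_by_component_closed_pointwise)
  have "L \<subseteq> h ` S" using L(1) in_components_subset by blast
  define K where "K = k ` L"
  have hom': "homeomorphism (UNIV :: 'a set) (ball c r) k h"
    using hom homeomorphism_symD by blast
  have hK: "h ` K = L"
    by (simp add: K_def image_image homeomorphism_apply2[OF hom])
  have KS: "K \<subseteq> S"
  proof -
    have "K \<subseteq> k ` h ` S"
      unfolding K_def using \<open>L \<subseteq> h ` S\<close> by (rule image_mono)
    also have "k ` h ` S = S"
      using S homeomorphism_apply1[OF hom] by (auto simp: image_image subset_eq)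
    finally show ?thesis .
  qed
  have "closed L" using L(1) \<open>closed (h ` S)\<close> closed_components by blast
  then have "closedin (top_of_set (ball c r)) K"
    unfolding K_def by (intro homeomorphism_imp_closed_map[OF hom']) simp
  moreover have "connected K"
  proof -
    have "continuous_on L k"
      using homeomorphism_cont1[OF hom'] continuous_on_subset by blast
    then show ?thesis
      unfolding K_def using L(1) in_components_connected connected_continuous_image by blast
  qed
  moreover have "\<not> connected_component (ball c r - K) x y"
  proof
    assume "connected_component (ball c r - K) x y"
    then obtain T where T: "connected T" "T \<subseteq> ball c r - K" "x \<in> T" "y \<in> T"
      by (auto simp: connected_component_def)
    then have "T \<subseteq> ball c r" by blast
    then have "continuous_on T h"
      using homeomorphism_cont1[OF hom] continuous_on_subset by blast
    then have "connected (h ` T)"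
      using T(1) connected_continuous_image by blast
    moreover have "h ` T \<subseteq> - L"
    proof -
      have "h ` T \<subseteq> h ` (ball c r - K)" using T(2) by (rule image_mono)
      then show ?thesis using diff[of K] KS S hK by simp
    qed
    ultimately have "connected_component (- L) (h x) (h y)"
      using T(3,4) unfolding connected_component_def by blast
    then show False using L(2) by blast
  qed
  ultimately show thesis using KS that by blast
qed

text \<open>
  By the Sura-Bura theorem the frontier splits in the disc into two disjoint compact parts, one
  around \<open>x\<close> and one around \<open>y\<close>, and the points outside suitable disjoint neighbourhoods of these
  parts separate \<open>x\<close> from \<open>y\<close>. A connected separator \<open>S\<close> chosen among them misses the frontier,
  so it is contained in \<open>C\<close> or disjoint from it; the latter is impossible because it has to
  meet \<open>V\<close>, which joins \<open>x\<close> and \<open>y\<close> within \<open>C\<close>.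
\<close>

lemma exists_separator_in_interior:
  fixes C :: "'a::euclidean_space set"
  assumes "closed C" "0 < r" and V: "connected V" "V \<subseteq> C \<inter> ball c r" "x \<in> V" "y \<in> V"
    and x: "x \<in> frontier C" and y: "y \<in> frontier C"
    and sep: "\<not> connected_component (frontier C \<inter> cball c r) x y"
  obtains S where "connected S" "S \<subseteq> interior C \<inter> ball c r"
    "closedin (top_of_set (ball c r)) S" "\<not> connected_component (ball c r - S) x y"
proof -
  let ?D = "frontier C \<inter> cball c r"
  have comp: "compact ?D" by (simp add: closed_Int_compact)
  have xy: "x \<in> ball c r" "y \<in> ball c r" "x \<in> ?D" "y \<in> ?D"
    using V x y by (auto simp: less_imp_le)
  have "connected_component_set ?D x \<in> components ?D"
    using xy(3) by (rule componentsI)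
  moreover have "y \<notin> connected_component_set ?D x" using sep by simp
  ultimately obtain E where E: "x \<in> E" "y \<notin> E"
      "openin (top_of_set ?D) E" "closedin (top_of_set ?D) E"
    using Sura_Bura_compact[OF comp, of "connected_component_set ?D x"] xy(3)
      connected_component_refl[OF xy(3)] by blast
  have "compact E" using comp E(4) closedin_compact by blast
  moreover have "compact (?D - E)"
    using comp E(3) closedin_compact closedin_diff[of "top_of_set ?D" ?D E] by auto
  ultimately obtain O1 O2 where O: "open O1" "open O2" "E \<subseteq> O1" "?D - E \<subseteq> O2" "O1 \<inter> O2 = {}"
    using separation_normal_compact[of E "?D - E"] compact_imp_closed
    by (metis Diff_disjoint)
  define Q where "Q = ball c r - (O1 \<union> O2)"
  have clo: "closedin (top_of_set (ball c r)) Q"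
  proof -
    have "Q = ball c r \<inter> - (O1 \<union> O2)" by (auto simp: Q_def)
    then show ?thesis using O(1,2) by (metis closed_Compl closedin_closed_Int open_Un)
  qed
  have "\<not> connected_component (ball c r - Q) x y"
  proof
    assume "connected_component (ball c r - Q) x y"
    then obtain T where T: "connected T" "T \<subseteq> O1 \<union> O2" "x \<in> T" "y \<in> T"
      by (auto simp: connected_component_def Q_def)
    then show False
      using O E(1,2) xy(4) connectedD[of T O1 O2] by blast
  qed
  then obtain S where SQ: "connected S" "S \<subseteq> Q"
    and cloS: "closedin (top_of_set (ball c r)) S"
    and S: "\<not> connected_component (ball c r - S) x y"
    using separation_in_ball_by_component[OF \<open>0 < r\<close> clo xy(1,2)] by metis
  have "S \<inter> ?D = {}" using SQ O by (auto simp: Q_def)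
  then have disj: "S \<inter> frontier C = {}" using SQ by (force simp: Q_def)
  have "S \<inter> C \<noteq> {}"
  proof
    assume "S \<inter> C = {}"
    then have "V \<subseteq> ball c r - S" using V by blast
    then show False using S V unfolding connected_component_def by blast
  qed
  then have "S \<subseteq> C" using connected_Int_frontier[OF SQ(1), of C] disj by blast
  then have "S \<subseteq> interior C \<inter> ball c r"
    using disj SQ \<open>closed C\<close> by (auto simp: frontier_def Q_def)
  then show thesis using that SQ(1) cloS S by blast
qed


section \<open>The frontier of a planar set without holes\<close>

lemma inside_subset_ball:
  fixes L :: "'a::euclidean_space set"
  assumes "2 \<le> DIM('a)" and "L \<subseteq> ball c r"
  shows "inside L \<subseteq> ball c r"
proof -
  have "connected (- ball c r)"
    using assms(1) by (intro connected_complement_bounded_convex) auto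
  moreover have "\<not> bounded (- ball c r)"
    by (intro cobounded_imp_unbounded) simp
  moreover have "(ball c r - L) \<union> - ball c r = - L"
    using assms(2) by blast
  ultimately show ?thesis using inside_subset by blast
qed

text \<open>
  Points off \<open>C\<close> lie outside \<open>L\<close>, and the outside of a bounded set is connected in dimension at
  least two.
\<close>

lemma connected_component_avoiding_full:
  fixes L :: "'a::euclidean_space set"
  assumes "2 \<le> DIM('a)" and "compact L" "inside L \<subseteq> C" "L \<subseteq> C" and "a \<notin> C" "b \<notin> C"
  shows "connected_component (- L) a b"
proof -
  have "a \<in> outside L" "b \<in> outside L"
    using assms by (auto simp: outside_inside)
  moreover have "connected (outside L)"
    using assms(1,2) connected_outside compact_imp_bounded by blast
  moreover have "outside L \<subseteq> - L" using outside_no_overlap by blast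
  ultimately show ?thesis unfolding connected_component_def by blast
qed

text \<open>
  This is connectedness im kleinen of the frontier at \<open>x\<close>. The hypothesis \<open>full\<close> says that \<open>C\<close> has
  no holes near \<open>x\<close>, and \<open>lc\<close> that \<open>C\<close> is locally connected near \<open>x\<close>. The disc in these
  hypotheses has radius \<open>2 * r\<close> to leave room for continua in \<open>C\<close> around the points of the circle
  of radius \<open>r\<close>.
\<close>

lemma frontier_connected_im_kleinen:
  fixes C :: "'a::euclidean_space set"
  assumes dim: "DIM('a) = 2" and "closed C" and "0 < r" and x: "x \<in> frontier C"
    and full: "\<And>L. \<lbrakk>compact L; L \<subseteq> C \<inter> ball x (2 * r)\<rbrakk> \<Longrightarrow> inside L \<subseteq> C"
    and lc: "\<And>z e. \<lbrakk>z \<in> C \<inter> ball x (2 * r); 0 < e\<rbrakk> \<Longrightarrow>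
      \<exists>V d. 0 < d \<and> connected V \<and> V \<subseteq> C \<inter> ball z e \<and> C \<inter> ball z d \<subseteq> V"
  shows "\<exists>d>0. \<forall>y \<in> frontier C \<inter> ball x d. connected_component (frontier C \<inter> cball x r) x y"
proof (rule ccontr)
  assume neg: "\<not> ?thesis"
  have FC: "frontier C \<subseteq> C" using \<open>closed C\<close> frontier_subset_eq by blast
  define sep where "sep y S \<longleftrightarrow> y \<in> frontier C \<inter> ball x r \<and> connected S \<and> S \<subseteq> C \<inter> ball x r \<and>
    closedin (top_of_set (ball x r)) S \<and> \<not> connected_component (ball x r - S) x y" for y S
  have seps: "\<exists>y S. y \<in> ball x d \<and> sep y S \<and> x \<notin> S \<and> y \<notin> S" if "0 < d" for d
  proof -
    have "x \<in> C \<inter> ball x (2 * r)" using x FC \<open>0 < r\<close> by auto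
    then obtain V e where V: "0 < e" "connected V" "V \<subseteq> C \<inter> ball x r" "C \<inter> ball x e \<subseteq> V"
      using lc[of x r] \<open>0 < r\<close> by metis
    obtain y where y: "y \<in> frontier C" "y \<in> ball x (min d e)"
        "\<not> connected_component (frontier C \<inter> cball x r) x y"
      using neg \<open>0 < d\<close> V(1) by (metis IntE min_less_iff_conj)
    have "x \<in> V" "y \<in> V" using V x y FC by auto
    then obtain S where "connected S" "S \<subseteq> interior C \<inter> ball x r"
      "closedin (top_of_set (ball x r)) S" "\<not> connected_component (ball x r - S) x y"
      using exists_separator_in_interior[OF \<open>closed C\<close> \<open>0 < r\<close> V(2,3) _ _ x y(1,3)] by metis
    moreover have "y \<in> ball x r" using \<open>y \<in> V\<close> V(3) by blast
    moreover have "x \<notin> S" "y \<notin> S" using calculation(2) x y(1) by (auto simp: frontier_def)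
    ultimately have "sep y S" "x \<notin> S" "y \<notin> S"
      using y(1) interior_subset[of C] by (auto simp: sep_def)
    then show ?thesis using y(2) by (metis mem_ball min_less_iff_conj)
  qed
  \<comment> \<open>Radius \<open>r / 2\<close> keeps these continua away from \<open>x\<close> and inside the disc of radius \<open>2 * r\<close>.\<close>
  obtain \<Z> where "finite \<Z>" and cover: "C \<inter> sphere x r \<subseteq> \<Union>\<Z>"
    and \<Z>: "\<And>Z. Z \<in> \<Z> \<Longrightarrow> compact Z \<and> connected Z \<and> Z \<subseteq> C \<inter> ball x (2 * r) - ball x (r / 2)"
  proof -
    have "\<forall>z \<in> C \<inter> sphere x r. \<exists>V d. 0 < d \<and> connected V \<and> V \<subseteq> C \<inter> ball z (r / 2) \<and> C \<inter> ball z d \<subseteq> V"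
    proof
      fix z assume "z \<in> C \<inter> sphere x r"
      then show "\<exists>V d. 0 < d \<and> connected V \<and> V \<subseteq> C \<inter> ball z (r / 2) \<and> C \<inter> ball z d \<subseteq> V"
        using lc[of z "r / 2"] \<open>0 < r\<close> by auto
    qed
    then obtain V d where V: "\<And>z. z \<in> C \<inter> sphere x r \<Longrightarrow>
        0 < d z \<and> connected (V z) \<and> V z \<subseteq> C \<inter> ball z (r / 2) \<and> C \<inter> ball z (d z) \<subseteq> V z"
      by metis
    have comp: "compact (C \<inter> sphere x r)"
      using \<open>closed C\<close> by (simp add: closed_Int_compact)
    have "C \<inter> sphere x r \<subseteq> (\<Union>z \<in> C \<inter> sphere x r. ball z (d z))"
    proof
      fix z assume z: "z \<in> C \<inter> sphere x r"
      then have "z \<in> ball z (d z)" using V by simp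
      with z show "z \<in> (\<Union>z \<in> C \<inter> sphere x r. ball z (d z))" by blast
    qed
    then obtain F where F: "F \<subseteq> C \<inter> sphere x r" "finite F"
        "C \<inter> sphere x r \<subseteq> (\<Union>z \<in> F. ball z (d z))"
      by (rule compactE_image[OF comp open_ball])
    show thesis
    proof
      show "finite ((\<lambda>z. closure (V z)) ` F)" using F(2) by blast
      show "C \<inter> sphere x r \<subseteq> \<Union> ((\<lambda>z. closure (V z)) ` F)"
      proof
        fix w assume w: "w \<in> C \<inter> sphere x r"
        then obtain z where z: "z \<in> F" "w \<in> ball z (d z)" using F(3) by blast
        then have "w \<in> V z" using V[of z] F(1) w by blast
        then show "w \<in> \<Union> ((\<lambda>z. closure (V z)) ` F)"
          using z(1) closure_subset by blast
      qed
      fix Z assume "Z \<in> (\<lambda>z. closure (V z)) ` F"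
      then obtain z where z: "z \<in> C \<inter> sphere x r" "Z = closure (V z)" using F(1) by blast
      have "Z \<subseteq> C \<inter> cball z (r / 2)"
        unfolding z(2) using V[OF z(1)] \<open>closed C\<close>
        by (intro closure_minimal) (auto intro: less_imp_le)
      moreover have "cball z (r / 2) \<subseteq> ball x (2 * r) - ball x (r / 2)"
      proof
        fix w assume "w \<in> cball z (r / 2)"
        then have "dist z w \<le> r / 2" "dist x z = r" using z(1) by auto
        then show "w \<in> ball x (2 * r) - ball x (r / 2)"
          using dist_triangle[of x w z] dist_triangle[of x z w] \<open>0 < r\<close>
          by (auto simp: dist_commute)
      qed
      moreover have "compact Z" unfolding z(2) using V[OF z(1)]
        by (meson bounded_ball bounded_subset compact_closure le_infE)
      moreover have "connected Z" unfolding z(2) using V[OF z(1)] connected_imp_connected_closure by blast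
      ultimately show "compact Z \<and> connected Z \<and> Z \<subseteq> C \<inter> ball x (2 * r) - ball x (r / 2)"
        by blast
    qed
  qed
  \<comment> \<open>Of the finitely many possible traces, one must occur for separators of points arbitrarily
      close to \<open>x\<close>.\<close>
  define trace where "trace S = {Z \<in> \<Z>. Z \<inter> closure S \<noteq> {}}" for S
  obtain I where I: "\<And>d. 0 < d \<Longrightarrow>
    \<exists>y S. y \<in> ball x d \<and> sep y S \<and> x \<notin> S \<and> y \<notin> S \<and> trace S = I"
  proof (rule ccontr)
    assume "\<not> thesis"
    with that have "\<forall>I. \<exists>d>0. \<forall>y S. y \<in> ball x d \<longrightarrow> sep y S \<longrightarrow> x \<notin> S \<longrightarrow> y \<notin> S \<longrightarrow> trace S \<noteq> I"
      by metis
    then obtain d where d: "\<And>I. 0 < d I"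
      "\<And>I y S. \<lbrakk>y \<in> ball x (d I); sep y S; x \<notin> S; y \<notin> S\<rbrakk> \<Longrightarrow> trace S \<noteq> I" by metis
    define m where "m = Min (d ` Pow \<Z>)"
    have "0 < m" unfolding m_def using d(1) \<open>finite \<Z>\<close>
      by (subst Min_gr_iff) auto
    then obtain y S where yS: "y \<in> ball x m" "sep y S" "x \<notin> S" "y \<notin> S" using seps by metis
    have "m \<le> d (trace S)" unfolding m_def using \<open>finite \<Z>\<close>
      by (intro Min_le) (auto simp: trace_def)
    then have "y \<in> ball x (d (trace S))" using yS(1) by simp
    then show False using d(2) yS(2-4) by blast
  qed
  have clS: "compact (closure S)" "connected (closure S)" "closure S \<subseteq> C \<inter> cball x r"
      "closure S \<inter> ball x r = S" if "sep y S" for y S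
  proof -
    have S: "connected S" "S \<subseteq> C \<inter> ball x r" "closedin (top_of_set (ball x r)) S"
      using that by (auto simp: sep_def)
    then show "connected (closure S)" using connected_imp_connected_closure by blast
    show "closure S \<subseteq> C \<inter> cball x r"
      using S(2) \<open>closed C\<close> by (intro closure_minimal) (auto intro: less_imp_le)
    then show "compact (closure S)"
      by (meson bounded_cball bounded_subset closed_closure compact_eq_bounded_closed le_infE)
    show "closure S \<inter> ball x r = S"
    proof -
      obtain T where "closed T" "S = ball x r \<inter> T"
        using S(3) by (auto simp: closedin_closed)
      then show ?thesis using closure_minimal[of S T] closure_subset[of S] by blast
    qed
  qed
  \<comment> \<open>The first separator is arbitrary; the second belongs to a point \<open>y2\<close> so close to \<open>x\<close> that
      the first one no longer separates it from \<open>x\<close>.\<close>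
  obtain y1 S1 where S1: "sep y1 S1" "x \<notin> S1" "trace S1 = I"
    using I[of 1] by auto
  obtain d where "0 < d" "d \<le> r / 2" and d: "ball x d \<inter> closure S1 = {}"
  proof -
    have "x \<notin> closure S1" using clS(4)[OF S1(1)] S1(2) \<open>0 < r\<close> centre_in_ball by blast
    then obtain e where e: "0 < e" "ball x e \<subseteq> - closure S1"
      using open_contains_ball[of "- closure S1"] by (metis Compl_iff closed_closure open_Compl)
    moreover have "ball x (min e (r / 2)) \<subseteq> ball x e" by (simp add: subset_ball)
    ultimately have "ball x (min e (r / 2)) \<inter> closure S1 = {}" by blast
    then show thesis using that[of "min e (r / 2)"] e(1) \<open>0 < r\<close> by simp
  qed
  obtain y2 S2 where S2: "y2 \<in> ball x d" "sep y2 S2" "x \<notin> S2" "y2 \<notin> S2" "trace S2 = I"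
    using I[OF \<open>0 < d\<close>] by auto
  define X where "X = closure S1 \<union> closure S2 \<union> \<Union>I"
  define Y where "Y = sphere x r \<union> closure S1 \<union> \<Union>I"
  have "I \<subseteq> \<Z>" using S1(3) by (auto simp: trace_def)
  then have "finite I" using \<open>finite \<Z>\<close> finite_subset by blast
  have I': "compact Z" "connected Z" "Z \<subseteq> C \<inter> ball x (2 * r) - ball x (r / 2)" if "Z \<in> I" for Z
    using \<Z>[of Z] that \<open>I \<subseteq> \<Z>\<close> by blast+
  have UI: "compact (\<Union>I)" "\<Union>I \<subseteq> C \<inter> ball x (2 * r) - ball x (r / 2)"
    using compact_Union[OF \<open>finite I\<close> I'(1)] I'(3) by (simp_all add: Union_least)
  have "compact X" "compact Y"
    unfolding X_def Y_def using clS(1) S1(1) S2(2) UI(1) by (auto intro!: compact_Un)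
  have "cball x r \<subseteq> ball x (2 * r)" using \<open>0 < r\<close> by auto
  then have XC: "X \<subseteq> C \<inter> ball x (2 * r)"
    unfolding X_def using clS(3)[OF S1(1)] clS(3)[OF S2(2)] UI(2) by blast
  have "connected (X \<inter> Y)"
  proof -
    \<comment> \<open>By equality of the traces, the points where \<open>S2\<close> reaches the circle are absorbed by
        continua that are attached to \<open>S1\<close>.\<close>
    have "closure S2 \<inter> sphere x r \<subseteq> \<Union>I"
    proof
      fix w assume w: "w \<in> closure S2 \<inter> sphere x r"
      then obtain Z where "Z \<in> \<Z>" "w \<in> Z" using cover clS(3)[OF S2(2)] by blast
      then have "Z \<in> trace S2" using w by (auto simp: trace_def)
      then show "w \<in> \<Union>I" using S2(5) \<open>w \<in> Z\<close> by blast
    qed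
    moreover have "closure S2 \<inter> closure S1 \<subseteq> closure S1" by blast
    ultimately have "X \<inter> Y = closure S1 \<union> \<Union>I" unfolding X_def Y_def by blast
    moreover have "connected (closure S1 \<union> \<Union>I)"
    proof (cases "S1 = {}")
      case True
      then have "I = {}" using S1(3) by (auto simp: trace_def)
      then show ?thesis using True by simp
    next
      case False
      then obtain s where s: "s \<in> closure S1" using closure_subset by blast
      have "connected (\<Union>(insert (closure S1) ((\<lambda>Z. closure S1 \<union> Z) ` I)))"
      proof (rule connected_Union)
        fix T assume T: "T \<in> insert (closure S1) ((\<lambda>Z. closure S1 \<union> Z) ` I)"
        then show "connected T"
        proof (cases "T = closure S1")
          case True
          then show ?thesis using clS(2)[OF S1(1)] by simp
        next
          case False
          then obtain Z where Z: "Z \<in> I" "T = closure S1 \<union> Z" using T by blast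
          then have "closure S1 \<inter> Z \<noteq> {}" using S1(3) by (auto simp: trace_def)
          then show ?thesis
            using connected_Un[OF clS(2)[OF S1(1)] I'(2)[OF Z(1)]] Z(2) by blast
        qed
      next
        show "\<Inter>(insert (closure S1) ((\<lambda>Z. closure S1 \<union> Z) ` I)) \<noteq> {}" using s by blast
      qed
      moreover have "\<Union>(insert (closure S1) ((\<lambda>Z. closure S1 \<union> Z) ` I)) = closure S1 \<union> \<Union>I"
        by blast
      ultimately show ?thesis by simp
    qed
    ultimately show ?thesis by simp
  qed
  have cloS2: "open (ball x r - S2)"
  proof -
    obtain T where "closed T" "S2 = ball x r \<inter> T"
      using S2(2) by (auto simp: sep_def closedin_closed)
    then have "ball x r - S2 = ball x r - T" by blast
    then show ?thesis using \<open>closed T\<close> by (simp add: open_Diff)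
  qed
  \<comment> \<open>The points \<open>x\<close> and \<open>y2\<close> belong to \<open>C\<close>; only nearby points off \<open>C\<close> can be joined in the
      complement of \<open>X\<close>.\<close>
  have near: "\<exists>z'. z' \<notin> C \<and> z' \<in> ball x d \<and> connected_component (ball x r - S2) z z'"
    if z: "z \<in> frontier C" "z \<in> ball x d" "z \<notin> S2" for z
  proof -
    have "z \<in> (ball x r - S2) \<inter> ball x d"
      using z \<open>d \<le> r / 2\<close> \<open>0 < r\<close> by auto
    then obtain e where e: "0 < e" "ball z e \<subseteq> (ball x r - S2) \<inter> ball x d"
      using open_contains_ball[of "(ball x r - S2) \<inter> ball x d"] cloS2
      by (meson open_Int open_ball)
    obtain z' where z': "z' \<notin> C" "z' \<in> ball z e"
      using z(1) e(1) unfolding frontier_straddle by (metis mem_Collect_eq mem_ball)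
    have "connected (ball z e)" "z \<in> ball z e" using e(1) by auto
    then show ?thesis using e(2) z' unfolding connected_component_def by blast
  qed
  obtain x' where x': "x' \<notin> C" "x' \<in> ball x d" "connected_component (ball x r - S2) x x'"
    using near[of x] x S2(3) \<open>0 < d\<close> by auto
  obtain y' where y': "y' \<notin> C" "y' \<in> ball x d" "connected_component (ball x r - S2) y2 y'"
    using near[of y2] S2 by (auto simp: sep_def)
  have "connected_component (- (X \<union> Y)) x' y'"
  proof (rule Janiszewski_plane[OF dim \<open>compact X\<close> \<open>compact Y\<close> \<open>connected (X \<inter> Y)\<close>])
    show "connected_component (- X) x' y'"
      using connected_component_avoiding_full[OF _ \<open>compact X\<close> full[OF \<open>compact X\<close> XC] _ x'(1) y'(1)]
        dim XC by auto
    have "ball x d \<inter> sphere x r = {}" "ball x d \<subseteq> ball x (r / 2)"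
      using \<open>d \<le> r / 2\<close> \<open>0 < r\<close> by auto
    then have "ball x d \<subseteq> - Y" using d UI(2) unfolding Y_def by blast
    then show "connected_component (- Y) x' y'"
      using x'(2) y'(2) connected_ball[of x d] unfolding connected_component_def by blast
  qed
  then obtain T where T: "connected T" "T \<subseteq> - (X \<union> Y)" "x' \<in> T" "y' \<in> T"
    by (auto simp: connected_component_def)
  have "T \<subseteq> ball x r"
  proof (rule ccontr)
    assume "\<not> T \<subseteq> ball x r"
    moreover have "x' \<in> T \<inter> ball x r" using T(3) connected_component_in[OF x'(3)] by blast
    ultimately have "T \<inter> frontier (ball x r) \<noteq> {}"
      using connected_Int_frontier[OF T(1), of "ball x r"] by blast
    then show False using T(2) \<open>0 < r\<close> by (auto simp: Y_def frontier_ball)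
  qed
  then have "T \<subseteq> ball x r - S2" using T(2) closure_subset[of S2] by (auto simp: X_def)
  then have "connected_component (ball x r - S2) x' y'"
    using T unfolding connected_component_def by blast
  then have "connected_component (ball x r - S2) x y2"
    using x'(3) y'(3) connected_component_sym connected_component_trans by metis
  then show False using S2(2) by (auto simp: sep_def)
qed

section \<open>Patches of a graph\<close>

lemma openin_fst_preimage:
  assumes "continuous_map G euclidean fst" and "open A"
  shows "openin G {p \<in> topspace G. fst p \<in> A}"
  using openin_continuous_map_preimage[OF assms(1)] assms(2) by simp

text \<open>
  On a compact neighbourhood \<open>K\<close> of the point in the graph the projection is a homeomorphism onto
  its image \<open>C\<close>. By injectivity \<open>x\<close> is not in the compact projection of \<open>K - U\<close>, so a ball around
  \<open>x\<close> avoids it.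
\<close>

lemma exists_compact_graph_patch:
  fixes G :: "('a::euclidean_space \<times> 'b) topology"
  assumes G: "locally_compact_space G" "Hausdorff_space G" "continuous_map G euclidean fst"
    and top: "topspace G = range (\<lambda>z. (z, f z))"
    and W: "openin G W" "(x, f x) \<in> W"
  obtains U C e where "openin G U" "(x, f x) \<in> U" "compact C" "0 < e"
    "continuous_map (top_of_set C) G (\<lambda>z. (z, f z))"
    "U \<subseteq> (\<lambda>z. (z, f z)) ` C" "(\<lambda>z. (z, f z)) ` C \<subseteq> W"
    "(\<lambda>z. (z, f z)) ` (C \<inter> ball x e) \<subseteq> U"
proof -
  let ?g = "\<lambda>z. (z, f z)"
  obtain U K where U: "openin G U" "(x, f x) \<in> U" "U \<subseteq> K" and K: "compactin G K" "K \<subseteq> W"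
    using G(1,2) W locally_compact_space_neighbourhood_base[of G]
    unfolding neighbourhood_base_of by metis
  have Ksub: "K \<subseteq> range ?g" using compactin_subset_topspace[OF K(1)] top by simp
  define C where "C = fst ` K"
  have gC: "?g ` C = K" using Ksub by (force simp: C_def)
  have compact_fst: "compact (fst ` L)" if "compactin G L" for L
    using image_compactin[OF that G(3)] by simp
  have fstK: "continuous_map (subtopology G K) (top_of_set C) fst"
    using G(3) by (auto simp: C_def continuous_map_in_subtopology continuous_map_from_subtopology)
  have "homeomorphic_map (subtopology G K) (top_of_set C) fst"
  proof (rule bijective_closed_imp_homeomorphic_map[OF fstK])
    show "closed_map (subtopology G K) (top_of_set C) fst"
      using K(1) compactin_subspace[of G K]
      by (intro T1_Spaces.continuous_imp_closed_map[OF fstK])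
        (auto simp: Hausdorff_space_subtopology)
    show "fst ` topspace (subtopology G K) = topspace (top_of_set C)"
      using compactin_subset_topspace[OF K(1)] by (simp add: C_def Int_absorb1)
    show "inj_on fst (topspace (subtopology G K))"
      using Ksub by (intro inj_on_inverseI[of _ ?g]) auto
  qed
  then obtain k where "homeomorphic_maps (subtopology G K) (top_of_set C) fst k"
    using homeomorphic_map_maps by blast
  then have k: "continuous_map (top_of_set C) (subtopology G K) k"
      "\<And>z. z \<in> C \<Longrightarrow> fst (k z) = z"
    by (auto simp: homeomorphic_maps_def)
  have kg: "k z = ?g z" if "z \<in> C" for z
  proof -
    have "k z \<in> K" using k(1) that by (auto simp: continuous_map_def)
    then show ?thesis using k(2)[OF that] Ksub by auto
  qed
  have "continuous_map (top_of_set C) (subtopology G K) ?g"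
    by (rule continuous_map_eq[OF k(1)]) (simp add: kg)
  then have g: "continuous_map (top_of_set C) G ?g"
    using continuous_map_in_subtopology by blast
  have "compactin G (K - U)"
  proof -
    have "K - U = K \<inter> (topspace G - U)" using compactin_subset_topspace[OF K(1)] by blast
    then show ?thesis using compact_Int_closedin[OF K(1)] U(1) by (simp add: closedin_diff)
  qed
  then have "open (- fst ` (K - U))" using compact_fst compact_imp_closed by blast
  moreover have "x \<in> - fst ` (K - U)"
    using Ksub U(2) by auto
  ultimately obtain e where e: "0 < e" "ball x e \<subseteq> - fst ` (K - U)"
    by (meson open_contains_ball)
  have "?g ` (C \<inter> ball x e) \<subseteq> U"
  proof clarify
    fix z assume "z \<in> C" "z \<in> ball x e"
    then have "?g z \<in> K" "z \<notin> fst ` (K - U)" using gC e(2) by blast+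
    then show "?g z \<in> U" by force
  qed
  then show thesis
    using that[OF U(1,2) _ e(1) g] compact_fst[OF K(1)] U(3) K(2) gC by (simp add: C_def)
qed

text \<open>
  The graph over \<open>inside L - C\<close> is open. A point of its closure outside it would project to a point
  of \<open>C\<close> in the closure of \<open>inside L\<close>, hence in the ball, and so would lie in \<open>U\<close>; but \<open>U\<close> is open
  and projects into \<open>C\<close>.
\<close>

lemma inside_subset_graph_patch:
  fixes G :: "('a::euclidean_space \<times> 'b) topology"
  assumes dim: "2 \<le> DIM('a)" and G: "connected_space G" "continuous_map G euclidean fst"
    and top: "topspace G = range (\<lambda>z. (z, f z))"
    and U: "openin G U" "(x, f x) \<in> U" "U \<subseteq> (\<lambda>z. (z, f z)) ` C"
      "(\<lambda>z. (z, f z)) ` (C \<inter> ball x e) \<subseteq> U"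
    and "closed C" and L: "compact L" "L \<subseteq> C \<inter> ball x e"
  shows "inside L \<subseteq> C"
proof -
  define Q where "Q = inside L - C"
  let ?T = "{p \<in> topspace G. fst p \<in> Q}"
  have "open Q"
    unfolding Q_def using L(1) \<open>closed C\<close> by (simp add: open_Diff open_inside compact_imp_closed)
  have "openin G ?T" by (rule openin_fst_preimage[OF G(2) \<open>open Q\<close>])
  moreover have "closedin G ?T"
  proof -
    have "open (outside L)" using L(1) by (simp add: open_outside compact_imp_closed)
    then have "openin G (U \<union> {p \<in> topspace G. fst p \<in> outside L})"
      using U(1) openin_fst_preimage[OF G(2)] by blast
    moreover have "topspace G - ?T = U \<union> {p \<in> topspace G. fst p \<in> outside L}"
    proof (intro equalityI subsetI)
      fix p assume p: "p \<in> topspace G - ?T"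
      then obtain z where z: "p = (z, f z)" "z \<notin> Q" using top by auto
      have "inside L \<subseteq> ball x e" using inside_subset_ball[OF dim] L(2) by blast
      then have "z \<in> C \<inter> ball x e \<or> z \<in> outside L"
        using z(2) L(2) by (auto simp: Q_def outside_inside)
      then show "p \<in> U \<union> {p \<in> topspace G. fst p \<in> outside L}"
        using p U(4) z(1) by auto
    next
      fix p assume p: "p \<in> U \<union> {p \<in> topspace G. fst p \<in> outside L}"
      then have "p \<in> topspace G" using openin_subset[OF U(1)] by blast
      moreover have "fst p \<notin> Q"
        using p U(3) inside_Int_outside[of L] by (fastforce simp: Q_def)
      ultimately show "p \<in> topspace G - ?T" by blast
    qed
    ultimately show ?thesis by (simp add: closedin_def)
  qed
  ultimately have "?T = {} \<or> ?T = topspace G"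
    using G(1) unfolding connected_space_clopen_in by blast
  moreover have "(x, f x) \<in> topspace G - ?T"
    using U(2,3) top by (auto simp: Q_def)
  ultimately have "?T = {}" by blast
  then have "Q = {}" using top by auto
  then show ?thesis by (simp add: Q_def)
qed

lemma locally_connected_graph_patch:
  fixes G :: "('a::euclidean_space \<times> 'b) topology"
  assumes G: "locally_connected_space G" "continuous_map G euclidean fst"
    and top: "topspace G = range (\<lambda>z. (z, f z))"
    and U: "openin G U" "U \<subseteq> (\<lambda>z. (z, f z)) ` C" "(z, f z) \<in> U"
    and g: "continuous_map (top_of_set C) G (\<lambda>z. (z, f z))" and "z \<in> C" and "0 < e"
  shows "\<exists>V d. 0 < d \<and> connected V \<and> V \<subseteq> C \<inter> ball z e \<and> C \<inter> ball z d \<subseteq> V"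
proof -
  have "openin G (U \<inter> {p \<in> topspace G. fst p \<in> ball z e})"
    using U(1) openin_fst_preimage[OF G(2) open_ball] by blast
  moreover have "(z, f z) \<in> U \<inter> {p \<in> topspace G. fst p \<in> ball z e}"
    using U(3) \<open>0 < e\<close> top by auto
  ultimately obtain A where A: "openin G A" "connectedin G A" "(z, f z) \<in> A"
      "A \<subseteq> U \<inter> {p \<in> topspace G. fst p \<in> ball z e}"
    using G(1) unfolding locally_connected_space by meson
  have "connected (fst ` A)"
    using connectedin_continuous_map_image[OF G(2) A(2)] by simp
  moreover have "fst ` A \<subseteq> C \<inter> ball z e" using A(4) U(2) by fastforce
  moreover have "openin (top_of_set C) {w \<in> C. (w, f w) \<in> A}"
    using openin_continuous_map_preimage[OF g A(1)] by simp
  then obtain d where "0 < d" "ball z d \<inter> C \<subseteq> {w \<in> C. (w, f w) \<in> A}"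
    using A(3) \<open>z \<in> C\<close> unfolding openin_contains_ball by blast
  then have "C \<inter> ball z d \<subseteq> fst ` A" by force
  ultimately show ?thesis using \<open>0 < d\<close> by blast
qed

text \<open>
  If \<open>f\<close> is continuous at \<open>z\<close>, then the graph over a neighbourhood of \<open>z\<close> is contained in \<open>U\<close>, and
  so that neighbourhood is contained in \<open>C\<close>. Conversely, \<open>f\<close> is continuous on \<open>C\<close>.
\<close>

lemma topcontinuous_at_iff_interior_graph_patch:
  fixes f :: "'a::euclidean_space \<Rightarrow> 'b"
  assumes f: "f \<in> UNIV \<rightarrow> topspace Y"
    and U: "openin (subtopology (prod_topology euclidean Y) (graph_over UNIV f)) U"
      "U \<subseteq> (\<lambda>z. (z, f z)) ` C" "(z, f z) \<in> U"
    and g: "continuous_map (top_of_set C) (prod_topology euclidean Y) (\<lambda>z. (z, f z))"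
  shows "topcontinuous_at euclidean Y f z \<longleftrightarrow> z \<in> interior C"
proof
  assume "topcontinuous_at euclidean Y f z"
  then have cont: "\<And>V. openin Y V \<Longrightarrow> f z \<in> V \<Longrightarrow> \<exists>B. open B \<and> z \<in> B \<and> (\<forall>y\<in>B. f y \<in> V)"
    by (auto simp: topcontinuous_at_def)
  obtain U' where U': "openin (prod_topology euclidean Y) U'" "U = U' \<inter> graph_over UNIV f"
    using U(1) by (auto simp: openin_subtopology)
  then obtain A V where AV: "open A" "openin Y V" "z \<in> A" "f z \<in> V" "A \<times> V \<subseteq> U'"
    using U(3) unfolding openin_prod_topology_alt by (auto 0 3)
  obtain B where B: "open B" "z \<in> B" "\<forall>y\<in>B. f y \<in> V" using cont AV(2,4) by blast
  have "A \<inter> B \<subseteq> C"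
  proof
    fix w assume "w \<in> A \<inter> B"
    then have "(w, f w) \<in> U" using AV(5) B(3) U'(2) by (auto simp: graph_over_def)
    then show "w \<in> C" using U(2) by auto
  qed
  then show "z \<in> interior C" using AV(1,3) B(1,2) by (meson IntI interiorI open_Int)
next
  assume z: "z \<in> interior C"
  have fC: "continuous_map (top_of_set C) Y f"
    using continuous_map_compose[OF g continuous_map_snd] by (simp add: o_def)
  show "topcontinuous_at euclidean Y f z"
    unfolding topcontinuous_at_def
  proof (intro conjI allI impI)
    fix V assume V: "openin Y V \<and> f z \<in> V"
    then have "openin (top_of_set C) {w \<in> C. f w \<in> V}"
      using openin_continuous_map_preimage[OF fC, of V] by simp
    then obtain B where B: "open B" "{w \<in> C. f w \<in> V} = C \<inter> B" by (auto simp: openin_open)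
    have "open (interior C \<inter> B)" "z \<in> interior C \<inter> B" "\<forall>y\<in>interior C \<inter> B. f y \<in> V"
      using B V z interior_subset[of C] by blast+
    then show "\<exists>B. openin euclidean B \<and> z \<in> B \<and> (\<forall>y\<in>B. f y \<in> V)" by auto
  qed (use f in auto)
qed

section \<open>Local connectedness of the graph over the discontinuities\<close>

theorem corollary16:
  fixes Y :: "'b topology" and f :: "real ^ 2 \<Rightarrow> 'b"
  assumes "locally_compact_space Y" and "second_countable Y" and "metrizable_space Y"
    and "f \<in> UNIV \<rightarrow> topspace Y"
    and "closedin (prod_topology euclidean Y) (graph_over UNIV f)"
    and "connectedin (prod_topology euclidean Y) (graph_over UNIV f)"
    and "locally_connected_space (subtopology (prod_topology euclidean Y) (graph_over UNIV f))"
  shows "locally_connected_space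
    (subtopology (prod_topology euclidean Y) (graph_over (discontinuity_set euclidean Y f) f))"
proof -
  let ?g = "\<lambda>z. (z, f z)" and ?P = "prod_topology euclidean Y"
  define G where "G = subtopology ?P (graph_over UNIV f)"
  define D where "D = discontinuity_set euclidean Y f"
  have top: "topspace G = range ?g"
    using \<open>f \<in> UNIV \<rightarrow> topspace Y\<close> by (auto simp: G_def graph_over_def)
  have haus: "Hausdorff_space G"
    unfolding G_def using \<open>metrizable_space Y\<close>
    by (simp add: Hausdorff_space_subtopology Hausdorff_space_prod_topology
        metrizable_imp_Hausdorff_space)
  have lcomp: "locally_compact_space G"
    unfolding G_def using \<open>locally_compact_space Y\<close>
    by (intro locally_compact_space_closed_subset[OF _ assms(5)])
      (simp add: locally_compact_space_prod_topology locally_compact_space_euclidean)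
  have conn: "connected_space G" and lconn: "locally_connected_space G"
    using assms(6,7) by (auto simp: G_def connectedin_def)
  have cfst: "continuous_map G euclidean fst"
    unfolding G_def by (intro continuous_map_from_subtopology continuous_map_fst)
  have "graph_over D f \<subseteq> graph_over UNIV f" by (auto simp: graph_over_def)
  then have GD: "subtopology ?P (graph_over D f) = subtopology G (graph_over D f)"
    unfolding G_def by (simp add: subtopology_subtopology Int_absorb1)
  have "locally_connected_space (subtopology G (graph_over D f))"
    unfolding locally_connected_space_im_kleinen
  proof (intro allI impI, elim conjE)
    fix N p assume N: "openin (subtopology G (graph_over D f)) N" and "p \<in> N"
    obtain W where W: "openin G W" "N = W \<inter> graph_over D f"
      using N by (auto simp: openin_subtopology)
    obtain x where x: "p = (x, f x)" "x \<in> D"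
      using \<open>p \<in> N\<close> W(2) by (auto simp: graph_over_def)
    have xW: "(x, f x) \<in> W" using \<open>p \<in> N\<close> W(2) x(1) by blast
    obtain U C e where U: "openin G U" "(x, f x) \<in> U" "U \<subseteq> ?g ` C" "?g ` (C \<inter> ball x e) \<subseteq> U"
      and C: "compact C" "?g ` C \<subseteq> W" and "0 < e"
      and g: "continuous_map (top_of_set C) G ?g"
      by (rule exists_compact_graph_patch[OF lcomp haus cfst top W(1) xW])
    have "closed C" using C(1) by (rule compact_imp_closed)
    have gP: "continuous_map (top_of_set C) ?P ?g"
      using g unfolding G_def continuous_map_in_subtopology by blast
    have D_iff: "z \<in> D \<longleftrightarrow> z \<in> frontier C" if "z \<in> C" "z \<in> ball x e" for z
    proof -
      have "(z, f z) \<in> U" using U(4) that by blast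
      then have "topcontinuous_at euclidean Y f z \<longleftrightarrow> z \<in> interior C"
        using topcontinuous_at_iff_interior_graph_patch[OF assms(4) _ U(3) _ gP] U(1)
        by (simp add: G_def)
      then show ?thesis
        using that(1) \<open>closed C\<close> by (simp add: D_def discontinuity_set_def frontier_def)
    qed
    have "x \<in> C" using U(2,3) by auto
    then have "x \<in> frontier C" using D_iff x(2) \<open>0 < e\<close> by simp
    have "\<exists>d>0. \<forall>y\<in>frontier C \<inter> ball x d. connected_component (frontier C \<inter> cball x (e / 2)) x y"
    proof (rule frontier_connected_im_kleinen)
      show "\<And>L. \<lbrakk>compact L; L \<subseteq> C \<inter> ball x (2 * (e / 2))\<rbrakk> \<Longrightarrow> inside L \<subseteq> C"
        using inside_subset_graph_patch[OF _ conn cfst top U \<open>closed C\<close>] by simp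
      show "\<exists>V d. 0 < d \<and> connected V \<and> V \<subseteq> C \<inter> ball z r \<and> C \<inter> ball z d \<subseteq> V"
        if "z \<in> C \<inter> ball x (2 * (e / 2))" "0 < r" for z r
      proof -
        have "z \<in> C" "z \<in> C \<inter> ball x e" using that(1) by auto
        then have "(z, f z) \<in> U" using U(4) by blast
        then show ?thesis
          by (rule locally_connected_graph_patch[OF lconn cfst top U(1,3) _ g \<open>z \<in> C\<close> that(2)])
      qed
    qed (use \<open>closed C\<close> \<open>0 < e\<close> \<open>x \<in> frontier C\<close> in auto)
    then obtain d where d: "0 < d"
        "\<And>y. y \<in> frontier C \<inter> ball x d \<Longrightarrow> connected_component (frontier C \<inter> cball x (e / 2)) x y"
      by blast
    define M where "M = N \<inter> (U \<inter> {q \<in> topspace G. fst q \<in> ball x (min d e)})"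
    have ope: "openin G (U \<inter> {q \<in> topspace G. fst q \<in> ball x (min d e)})"
      using U(1) openin_fst_preimage[OF cfst open_ball] by blast
    have "openin (subtopology G (graph_over D f)) M"
    proof -
      have "M = (W \<inter> (U \<inter> {q \<in> topspace G. fst q \<in> ball x (min d e)})) \<inter> graph_over D f"
        unfolding M_def W(2) by blast
      then show ?thesis
        using openin_Int[OF W(1) ope] openin_subtopology by blast
    qed
    moreover have "p \<in> M"
      using \<open>p \<in> N\<close> U(2) top d(1) \<open>0 < e\<close> by (auto simp: M_def x(1))
    moreover have "\<exists>K. connectedin (subtopology G (graph_over D f)) K \<and> K \<subseteq> N \<and> p \<in> K \<and> q \<in> K"
      if "q \<in> M" for q
    proof -
      obtain y where y: "q = (y, f y)" "y \<in> D" "y \<in> C" "y \<in> ball x d" "y \<in> ball x e"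
      proof -
        from \<open>q \<in> M\<close> obtain y where y: "q = (y, f y)" "y \<in> D"
          by (auto simp: M_def W(2) graph_over_def)
        moreover have "y \<in> C" using \<open>q \<in> M\<close> U(3) y(1) by (auto simp: M_def)
        moreover have "y \<in> ball x d" "y \<in> ball x e" using \<open>q \<in> M\<close> y(1) by (auto simp: M_def)
        ultimately show thesis by (rule that)
      qed
      then obtain T where T: "connected T" "T \<subseteq> frontier C \<inter> cball x (e / 2)" "x \<in> T" "y \<in> T"
        using d(2)[of y] D_iff[of y] unfolding connected_component_def by auto
      have "T \<subseteq> C" using T(2) frontier_subset_closed[OF \<open>closed C\<close>] by blast
      have "T \<subseteq> D"
      proof
        fix z assume z: "z \<in> T"
        then have "dist x z \<le> e / 2" using T(2) by auto
        then have "z \<in> ball x e" using \<open>0 < e\<close> by simp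
        then show "z \<in> D" using D_iff z T(2) \<open>T \<subseteq> C\<close> by blast
      qed
      then have "?g ` T \<subseteq> graph_over D f" by (auto simp: graph_over_def)
      moreover have "?g ` T \<subseteq> W" using C(2) \<open>T \<subseteq> C\<close> by blast
      moreover have "connectedin G (?g ` T)"
        using T(1) \<open>T \<subseteq> C\<close>
        by (intro connectedin_continuous_map_image[OF g]) (simp add: connectedin_subtopology)
      ultimately show ?thesis
        using T(3,4) by (intro exI[of _ "?g ` T"]) (auto simp: connectedin_subtopology W(2) x(1) y(1))
    qed
    ultimately show "\<exists>M. openin (subtopology G (graph_over D f)) M \<and> p \<in> M \<and> M \<subseteq> N \<and>
        (\<forall>q\<in>M. \<exists>K. connectedin (subtopology G (graph_over D f)) K \<and> K \<subseteq> N \<and> p \<in> K \<and> q \<in> K)"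
      by (intro exI[of _ M]) (auto simp: M_def)
  qed
  then show ?thesis unfolding GD[unfolded D_def] D_def .
qed

end
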